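(* There exists a strictly increasing sequence of positive integers $m_1<m_2<m_3<\cdots$ such that the sequence $\delta\{q_{m_i}\}-\{p_{m_i}\}$ $(i=1,2,3,\dots)$ converges and the integer sequences $[p_{m_i}]$ and $[q_{m_i}]$ $(i=1,2,3,\dots)$ are strictly increasing. For any such sequence $(m_i)$, put $$A_i:=[p_{m_{i+1}}]-[p_{m_i}],\qquad B_i:=[q_{m_{i+1}}]-[q_{m_i}]\qquad (i\ge1).$$ Then $\delta B_i-A_i\to0$ as $i\to\infty$. Moreover, if $\delta\ne\frac{A_i}{B_i}$ for every positive integer $i$, then $\delta$ is irrational.
   Context: $\delta=\int_0^\infty\frac{e^{-t}}{t+1}\,dt$ is the Euler-Gompertz constant. $[y]$ and $\{y\}=y-[y]$ denote the integer part and the fractional part of a real number $y$. The rational numbers $p_m,q_m$ are defined by $p_{-1}=1$, $q_{-1}=0$, $p_0=0$, $q_0=1$, and, for $m\ge1$, $p_m=c_mp_{m-1}+p_{m-2}$, $q_m=c_mq_{m-1}+q_{m-2}$, where $c_m=1$ if $m$ is odd and $c_m=\frac{2}{m}$ if $m$ is even. *)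

theory Defs
  imports "HOL-Analysis.Analysis"
begin

definition euler_gompertz :: real where
  "euler_gompertz = integral {0..} (\<lambda>t::real. exp (- t) / (t + 1))"

definition cf_coeff :: "nat \<Rightarrow> rat" where
  "cf_coeff m = (if odd m then 1 else 2 / of_nat m)"

text \<open>
  The recurrence $x_m = c_m x_{m-1} + x_{m-2}$ starts at index $-1$; the function below is
  shifted by one: its value at \<open>n\<close> is $x_{n-1}$, with \<open>a\<close> $= x_{-1}$ and \<open>b\<close> $= x_0$.
\<close>

fun cf_rec :: "rat \<Rightarrow> rat \<Rightarrow> nat \<Rightarrow> rat" where
  "cf_rec a b 0 = a"
| "cf_rec a b (Suc 0) = b"
| "cf_rec a b (Suc (Suc n)) = cf_coeff (Suc n) * cf_rec a b (Suc n) + cf_rec a b n"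

definition cf_p :: "nat \<Rightarrow> rat" where
  "cf_p m = cf_rec 1 0 (Suc m)"

definition cf_q :: "nat \<Rightarrow> rat" where
  "cf_q m = cf_rec 0 1 (Suc m)"

text \<open>Sequences $(m_i)_{i \ge 1}$ are indexed from \<open>0\<close>: the value at \<open>i\<close> is $m_{i+1}$.\<close>

definition admissible :: "(nat \<Rightarrow> nat) \<Rightarrow> bool" where
  "admissible m \<longleftrightarrow>
     strict_mono m \<and> (\<forall>i. m i > 0) \<and>
     convergent (\<lambda>i. euler_gompertz * real_of_rat (frac (cf_q (m i))) - real_of_rat (frac (cf_p (m i)))) \<and>
     strict_mono (\<lambda>i. \<lfloor>cf_p (m i)\<rfloor>) \<and> strict_mono (\<lambda>i. \<lfloor>cf_q (m i)\<rfloor>)"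

definition A_seq :: "(nat \<Rightarrow> nat) \<Rightarrow> nat \<Rightarrow> int" where
  "A_seq m i = \<lfloor>cf_p (m (Suc i))\<rfloor> - \<lfloor>cf_p (m i)\<rfloor>"

definition B_seq :: "(nat \<Rightarrow> nat) \<Rightarrow> nat \<Rightarrow> int" where
  "B_seq m i = \<lfloor>cf_q (m (Suc i))\<rfloor> - \<lfloor>cf_q (m i)\<rfloor>"

end

(* Put u = t / (t + 1), A k = \<integral> e^(-t) u^k / (t + 1) dt and B k = \<integral> e^(-t) u^k dt over t \<ge> 0.  Then
   B k - A k = B (k + 1) pointwise, and A k - A (k + 1) = B (k + 1) / (k + 1) by partial integration.
   Starting from A 0 = \<delta> and B 0 = 1, these are the recurrences of p_m and q_m, so
   \<delta> q_m - p_m is A k for m = 2k and - B k for m = 2k - 1; both tend to 0 by dominated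
   convergence.  As p_m and q_m tend to infinity, Bolzano-Weierstrass gives an admissible sequence,
   and \<delta> B_i - A_i is a difference of null sequences and of consecutive terms of a convergent
   sequence.  If \<delta> = a/b, the integers b (\<delta> B_i - A_i) tend to 0, so one of them vanishes. *)

theory Submission
  imports Defs
begin

section \<open>Weighted integrals over the half-line\<close>

lemma exp_minus_has_integral_atLeast_0: "((\<lambda>t::real. exp (- t)) has_integral 1) {0..}"
  using has_integral_exp_minus_to_infinity[of 1 0] by simp

lemma integrable_exp_minus_times_bounded:
  fixes f :: "real \<Rightarrow> real"
  assumes "continuous_on {0..} f" and "\<And>t. t \<ge> 0 \<Longrightarrow> \<bar>f t\<bar> \<le> 1"
  shows "(\<lambda>t. exp (- t) * f t) integrable_on {0..}"
proof (rule measurable_bounded_by_integrable_imp_integrable_real)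
  show "(\<lambda>t. exp (- t) * f t) \<in> borel_measurable (lebesgue_on {0..})"
    by (intro continuous_imp_measurable_on_sets_lebesgue continuous_intros assms) auto
  show "(\<lambda>t::real. exp (- t)) integrable_on {0..}"
    using exp_minus_has_integral_atLeast_0 by blast
  show "\<bar>exp (- t) * f t\<bar> \<le> exp (- t)" if "t \<in> {0..}" for t
    using assms(2)[of t] that by (simp add: abs_mult)
qed auto

text \<open>The factor \<open>exp (- t)\<close> is kept apart so that the other factor is bounded by
  1 for t \<ge> 0, the shape that \<open>integrable_exp_minus_times_bounded\<close> expects.\<close>

definition gompertz_A :: "nat \<Rightarrow> real" where
  "gompertz_A k = integral {0..} (\<lambda>t. exp (- t) * ((t / (t + 1)) ^ k / (t + 1)))"

definition gompertz_B :: "nat \<Rightarrow> real" where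
  "gompertz_B k = integral {0..} (\<lambda>t. exp (- t) * (t / (t + 1)) ^ k)"

lemma abs_ratio_power_le_1:
  fixes t :: real
  assumes "t \<ge> 0"
  shows "\<bar>(t / (t + 1)) ^ k\<bar> \<le> 1"
  using assms by (simp add: power_abs power_le_one)

lemma abs_ratio_power_div_le_1:
  fixes t :: real
  assumes "t \<ge> 0"
  shows "\<bar>(t / (t + 1)) ^ k / (t + 1)\<bar> \<le> 1"
proof -
  have "\<bar>(t / (t + 1)) ^ k / (t + 1)\<bar> = \<bar>(t / (t + 1)) ^ k\<bar> / (t + 1)"
    using assms by simp
  also have "\<dots> \<le> 1"
    using assms abs_ratio_power_le_1[OF assms, of k] by (subst divide_le_eq_1_pos) linarith+
  finally show ?thesis .
qed

lemma gompertz_A_has_integral: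
  "((\<lambda>t. exp (- t) * ((t / (t + 1)) ^ k / (t + 1))) has_integral gompertz_A k) {0..}"
  unfolding gompertz_A_def
  by (intro integrable_integral integrable_exp_minus_times_bounded abs_ratio_power_div_le_1
        continuous_intros) auto

lemma gompertz_B_has_integral:
  "((\<lambda>t. exp (- t) * (t / (t + 1)) ^ k) has_integral gompertz_B k) {0..}"
  unfolding gompertz_B_def
  by (intro integrable_integral integrable_exp_minus_times_bounded abs_ratio_power_le_1
        continuous_intros) auto

section \<open>Initial values and recurrences of the two integrals\<close>

lemma gompertz_A_0: "gompertz_A 0 = euler_gompertz"
  by (simp add: gompertz_A_def euler_gompertz_def)

lemma gompertz_B_0: "gompertz_B 0 = 1"
  using exp_minus_has_integral_atLeast_0 by (simp add: gompertz_B_def integral_unique)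

text \<open>Writing one factor t / (t + 1) as 1 - 1 / (t + 1) splits the integrand on the left into
  the two on the right.\<close>

lemma gompertz_B_Suc: "gompertz_B (Suc k) = gompertz_B k - gompertz_A k"
proof -
  have "((\<lambda>t. exp (- t) * (t / (t + 1)) ^ Suc k) has_integral gompertz_B k - gompertz_A k) {0..}"
  proof (rule has_integral_eq[OF _ has_integral_diff[OF gompertz_B_has_integral gompertz_A_has_integral]])
    fix t :: real
    assume "t \<in> {0..}"
    then have "t / (t + 1) = 1 - 1 / (t + 1)" by (simp add: field_simps)
    then have "(t / (t + 1)) ^ Suc k = (t / (t + 1)) ^ k * (1 - 1 / (t + 1))"
      by (metis power_Suc2)
    then show "exp (- t) * (t / (t + 1)) ^ k - exp (- t) * ((t / (t + 1)) ^ k / (t + 1))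
        = exp (- t) * (t / (t + 1)) ^ Suc k"
      by (simp only: right_diff_distrib mult_1_right times_divide_eq_right)
  qed
  then show ?thesis
    using gompertz_B_has_integral has_integral_unique by blast
qed

text \<open>
  The summand \<open>exp (- t)\<close> makes the integrand nonnegative, as \<open>has_integral_to_inf\<close> requires.
\<close>

lemma has_integral_ratio_power_derivative:
  "((\<lambda>t::real. exp (- t) * (real (Suc k) * (t / (t + 1)) ^ k / (t + 1)^2 - (t / (t + 1)) ^ Suc k)
      + exp (- t)) has_integral 1) {0..}"
  (is "(?h has_integral 1) {0..}")
proof (rule has_integral_to_inf)
  \<comment> \<open>The part - exp (- t) of \<open>F\<close> is an antiderivative of the added
    summand. It makes \<open>F 0\<close> equal to -1, while \<open>F\<close> tends to 0 at infinity,
    so the integral is 0 - F 0 = 1.\<close>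
  define F :: "real \<Rightarrow> real" where "F t = exp (- t) * ((t / (t + 1)) ^ Suc k - 1)" for t
  have deriv: "(F has_real_derivative ?h t) (at t within S)" if "t \<ge> 0" for t S
  proof -
    have ratio: "((\<lambda>t. t / (t + 1)) has_real_derivative 1 / (t + 1)^2) (at t within S)"
      using that by (auto intro!: derivative_eq_intros simp: field_simps power2_eq_square)
    show ?thesis
      unfolding F_def
    proof (rule DERIV_cong[OF DERIV_mult[OF _ DERIV_diff[OF DERIV_power[OF ratio] DERIV_const]]])
      show "((\<lambda>t. exp (- t)) has_real_derivative - exp (- t)) (at t within S)"
        by (auto intro!: derivative_eq_intros)
    qed (simp add: algebra_simps del: power_Suc)
  qed
  have FTC: "(?h has_integral F y - F 0) {0..y}" if "y \<ge> 0" for y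
  proof (rule fundamental_theorem_of_calculus[OF that])
    show "(F has_vector_derivative ?h t) (at t within {0..y})" if "t \<in> {0..y}" for t
      unfolding has_real_derivative_iff_has_vector_derivative[symmetric] using that by (intro deriv) auto
  qed
  show "?h integrable_on {0..y}" for y
    by (cases "y \<ge> 0") (use FTC in blast, simp add: integrable_on_empty)
  have "((\<lambda>y::real. exp (- y) * ((y / (y + 1)) ^ Suc k - 1)) \<longlongrightarrow> 0) at_top"
  proof (rule Lim_null_comparison)
    show "((\<lambda>y::real. exp (- y)) \<longlongrightarrow> 0) at_top"
      by (rule filterlim_compose[OF exp_at_bot filterlim_uminus_at_bot_at_top])
    have "norm (exp (- y) * ((y / (y + 1)) ^ Suc k - 1)) \<le> exp (- y)" if "y \<ge> 0" for y :: real
    proof -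
      have "0 \<le> (y / (y + 1)) ^ Suc k" "(y / (y + 1)) ^ Suc k \<le> 1"
        using that abs_ratio_power_le_1[OF that, of "Suc k"] by (auto simp del: power_Suc)
      then show ?thesis by (simp add: abs_mult del: power_Suc)
    qed
    then show "\<forall>\<^sub>F y in at_top. norm (exp (- y) * ((y / (y + 1)) ^ Suc k - 1)) \<le> exp (- y)"
      using eventually_at_top_linorder by blast
  qed
  then have "((\<lambda>y. F y - F 0) \<longlongrightarrow> 0 - F 0) at_top"
    unfolding F_def by (intro tendsto_diff tendsto_const)
  moreover have "F 0 = -1" by (simp add: F_def)
  moreover have "\<forall>\<^sub>F y in at_top. integral {0..y} ?h = F y - F 0"
    using FTC by (meson eventually_at_top_linorderI integral_unique)
  ultimately show "((\<lambda>y. integral {0..y} ?h) \<longlongrightarrow> 1) at_top"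
    by (simp add: filterlim_cong)
  show "?h t \<ge> 0" if "t \<ge> 0" for t :: real
  proof -
    have "(t / (t + 1)) ^ Suc k \<le> 1"
      using abs_ratio_power_le_1[OF that, of "Suc k"] by linarith
    moreover have "0 \<le> real (Suc k) * (t / (t + 1)) ^ k / (t + 1)^2"
      using that by simp
    ultimately have "0 \<le> exp (- t) * (real (Suc k) * (t / (t + 1)) ^ k / (t + 1)^2
        - (t / (t + 1)) ^ Suc k + 1)"
      by (intro mult_nonneg_nonneg) auto
    then show ?thesis by (simp add: algebra_simps)
  qed
qed

text \<open>The integral of \<open>?g\<close> is evaluated twice: by partial integration, and
  through u^k / (t + 1) - u^(k + 1) / (t + 1) = u^k / (t + 1)^2 with u = t / (t + 1).\<close>

lemma gompertz_A_Suc: "gompertz_A (Suc k) = gompertz_A k - gompertz_B (Suc k) / real (Suc k)"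
proof -
  let ?g = "\<lambda>t::real. exp (- t) * (real (Suc k) * (t / (t + 1)) ^ k / (t + 1)^2)"
  \<comment> \<open>The subtracted 1 is the integral of the summand \<open>exp (- t)\<close> that
    \<open>has_integral_ratio_power_derivative\<close> carries for nonnegativity.\<close>
  have "(?g has_integral 1 - 1 + gompertz_B (Suc k)) {0..}"
    by (rule has_integral_eq[OF _ has_integral_add[OF has_integral_diff[OF
          has_integral_ratio_power_derivative exp_minus_has_integral_atLeast_0] gompertz_B_has_integral]])
       (simp add: algebra_simps)
  moreover have "(?g has_integral real (Suc k) * (gompertz_A k - gompertz_A (Suc k))) {0..}"
  proof (rule has_integral_eq[OF _ has_integral_mult_right[OF has_integral_diff[OF
          gompertz_A_has_integral gompertz_A_has_integral]]])
    fix t :: real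
    assume t: "t \<in> {0..}"
    then have "t / (t + 1) = 1 - 1 / (t + 1)" by (simp add: field_simps)
    then have "(t / (t + 1)) ^ Suc k = (t / (t + 1)) ^ k * (1 - 1 / (t + 1))"
      by (metis power_Suc2)
    then show "real (Suc k) * (exp (- t) * ((t / (t + 1)) ^ k / (t + 1))
        - exp (- t) * ((t / (t + 1)) ^ Suc k / (t + 1))) = ?g t"
      by (simp only:) (simp add: algebra_simps diff_divide_distrib power2_eq_square)
  qed
  ultimately have "gompertz_B (Suc k) = real (Suc k) * (gompertz_A k - gompertz_A (Suc k))"
    using has_integral_unique[of ?g "1 - 1 + gompertz_B (Suc k)" "{0..}"] by (simp only: diff_self add_0)
  then have "gompertz_B (Suc k) / real (Suc k) = gompertz_A k - gompertz_A (Suc k)"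
    by (simp only:) (simp del: of_nat_Suc)
  then show ?thesis by simp
qed

section \<open>Decay of the integrals\<close>

lemma ratio_power_tendsto_0:
  fixes t :: real
  assumes "t \<ge> 0"
  shows "(\<lambda>k. (t / (t + 1)) ^ k) \<longlonglongrightarrow> 0"
  using assms by (intro LIMSEQ_realpow_zero) auto

lemma gompertz_A_tendsto_0: "gompertz_A \<longlonglongrightarrow> 0"
proof -
  have "(\<lambda>k. integral {0..} (\<lambda>t::real. exp (- t) * ((t / (t + 1)) ^ k / (t + 1))))
      \<longlonglongrightarrow> integral {0..} (\<lambda>t::real. 0::real)"
  proof (rule dominated_convergence(2))
    show "(\<lambda>t. exp (- t) * ((t / (t + 1)) ^ k / (t + 1))) integrable_on {0::real..}" for k
      using gompertz_A_has_integral by blast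
    show "(\<lambda>t::real. exp (- t)) integrable_on {0..}"
      using exp_minus_has_integral_atLeast_0 by blast
    show "norm (exp (- t) * ((t / (t + 1)) ^ k / (t + 1))) \<le> exp (- t)" if "t \<in> {0..}" for k and t :: real
    proof -
      have "exp (- t) * \<bar>(t / (t + 1)) ^ k / (t + 1)\<bar> \<le> exp (- t) * 1"
        using that by (intro mult_left_mono abs_ratio_power_div_le_1) auto
      then show ?thesis by (simp only: real_norm_def abs_mult abs_exp_cancel mult_1_right)
    qed
    show "(\<lambda>k. exp (- t) * ((t / (t + 1)) ^ k / (t + 1))) \<longlonglongrightarrow> 0" if "t \<in> {0..}" for t :: real
      using that by (intro tendsto_mult_right_zero tendsto_divide_zero ratio_power_tendsto_0) auto
  qed
  then show ?thesis by (simp add: gompertz_A_def[abs_def])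
qed

lemma gompertz_B_tendsto_0: "gompertz_B \<longlonglongrightarrow> 0"
proof -
  have "(\<lambda>k. integral {0..} (\<lambda>t::real. exp (- t) * (t / (t + 1)) ^ k))
      \<longlonglongrightarrow> integral {0..} (\<lambda>t::real. 0::real)"
  proof (rule dominated_convergence(2))
    show "(\<lambda>t. exp (- t) * (t / (t + 1)) ^ k) integrable_on {0::real..}" for k
      using gompertz_B_has_integral by blast
    show "(\<lambda>t::real. exp (- t)) integrable_on {0..}"
      using exp_minus_has_integral_atLeast_0 by blast
    show "norm (exp (- t) * (t / (t + 1)) ^ k) \<le> exp (- t)" if "t \<in> {0..}" for k and t :: real
      using abs_ratio_power_le_1[of t k] that by (simp add: abs_mult)
    show "(\<lambda>k. exp (- t) * (t / (t + 1)) ^ k) \<longlonglongrightarrow> 0" if "t \<in> {0..}" for t :: real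
      using that by (intro tendsto_mult_right_zero ratio_power_tendsto_0) auto
  qed
  then show ?thesis by (simp add: gompertz_B_def[abs_def])
qed

section \<open>The linear forms \<delta> q_m - p_m\<close>

text \<open>The linear forms inherit the recurrence of p_m and q_m: the coefficient 1 reproduces
  \<open>gompertz_B_Suc\<close>, and 2 / (2k + 2) = 1 / (k + 1) reproduces
  \<open>gompertz_A_Suc\<close>. Index n of \<open>cf_rec\<close> stands for m = n - 1.\<close>

lemma cf_rec_approximation:
  "euler_gompertz * of_rat (cf_rec 0 1 (2 * k)) - of_rat (cf_rec 1 0 (2 * k)) = - gompertz_B k \<and>
   euler_gompertz * of_rat (cf_rec 0 1 (Suc (2 * k))) - of_rat (cf_rec 1 0 (Suc (2 * k))) = gompertz_A k"
proof (induction k)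
  case 0
  show ?case by (simp add: gompertz_A_0 gompertz_B_0)
next
  case (Suc k)
  let ?L = "\<lambda>n. euler_gompertz * of_rat (cf_rec 0 1 n) - of_rat (cf_rec 1 0 n)"
  have rec: "?L (Suc (Suc n)) = of_rat (cf_coeff (Suc n)) * ?L (Suc n) + ?L n" for n
    by (simp add: of_rat_add of_rat_mult algebra_simps)
  \<comment> \<open>Because of the shift, this even index belongs to the odd m = 2k + 1, where the
    coefficient is 1.\<close>
  have odd: "?L (2 * Suc k) = - gompertz_B (Suc k)"
    using Suc rec[of "2 * k"] by (simp add: cf_coeff_def gompertz_B_Suc del: cf_rec.simps)
  have "of_rat (cf_coeff (Suc (Suc (2 * k)))) = 1 / real (Suc k)"
    by (simp add: cf_coeff_def of_rat_divide of_rat_add of_rat_mult field_simps)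
  then have "?L (Suc (2 * Suc k)) = gompertz_A (Suc k)"
    using Suc odd rec[of "Suc (2 * k)"] by (simp add: gompertz_A_Suc del: cf_rec.simps of_nat_Suc)
  with odd show ?case by blast
qed

lemma gompertz_approximation_tendsto_0:
  "(\<lambda>m. euler_gompertz * of_rat (cf_q m) - of_rat (cf_p m)) \<longlonglongrightarrow> 0"
proof -
  define L where "L n = euler_gompertz * of_rat (cf_rec 0 1 n) - of_rat (cf_rec 1 0 n)" for n
  have "L \<longlonglongrightarrow> 0"
  proof (rule Lim_null_comparison)
    \<comment> \<open>The parity of n decides which of the two integrals occurs; the sum bounds both
      cases at once.\<close>
    have "\<bar>L n\<bar> \<le> \<bar>gompertz_A (n div 2)\<bar> + \<bar>gompertz_B (n div 2)\<bar>" for n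
      using cf_rec_approximation[of "n div 2", folded L_def] by (cases "even n") auto
    then show "\<forall>\<^sub>F n in sequentially. norm (L n) \<le> \<bar>gompertz_A (n div 2)\<bar> + \<bar>gompertz_B (n div 2)\<bar>"
      by simp
    have "filterlim (\<lambda>n::nat. n div 2) sequentially sequentially"
      by (rule filterlim_at_top_div_const_nat) simp
    then show "(\<lambda>n. \<bar>gompertz_A (n div 2)\<bar> + \<bar>gompertz_B (n div 2)\<bar>) \<longlonglongrightarrow> 0"
      by (intro tendsto_add_zero tendsto_rabs_zero filterlim_compose[OF gompertz_A_tendsto_0]
            filterlim_compose[OF gompertz_B_tendsto_0])
  qed
  then show ?thesis
    unfolding L_def cf_p_def cf_q_def by (rule LIMSEQ_Suc)
qed

section \<open>Growth of p_m and q_m\<close>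

text \<open>The two bounds support each other: adding two terms that are at least k + 1 gives the
  next even index, and dividing that term by k + 2 still adds at least 1 at the next odd index. The
  hypotheses cover both pairs of initial values, (1, 0) and (0, 1).\<close>

lemma cf_rec_linear_growth:
  assumes "a \<ge> 0" "b \<ge> 0" "a + b \<ge> 1"
  shows "cf_rec a b (Suc (Suc (2 * k))) \<ge> of_nat (Suc k) \<and>
         cf_rec a b (Suc (Suc (Suc (2 * k)))) \<ge> of_nat (Suc k)"
proof (induction k)
  case 0
  show ?case using assms by (simp add: cf_coeff_def)
next
  case (Suc k)
  let ?x = "cf_rec a b"
  let ?n = "Suc (Suc (2 * k))"
  have "?x (Suc (Suc ?n)) = ?x (Suc ?n) + ?x ?n"
    by (simp add: cf_coeff_def)
  \<comment> \<open>This turns the lower bound 2 (k + 1) for the sum into k + 2.\<close>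
  moreover have "(of_nat k :: rat) \<ge> 0" by simp
  ultimately have even: "?x (Suc (Suc ?n)) \<ge> of_nat (Suc (Suc k))"
    using Suc by (simp del: cf_rec.simps)
  have "cf_coeff (Suc (Suc ?n)) = 1 / of_nat (Suc (Suc k))"
    by (simp add: cf_coeff_def field_simps)
  then have "?x (Suc (Suc (Suc ?n))) = ?x (Suc (Suc ?n)) / of_nat (Suc (Suc k)) + ?x (Suc ?n)"
    by (subst cf_rec.simps) (simp del: cf_rec.simps of_nat_Suc)
  moreover have "?x (Suc (Suc ?n)) / of_nat (Suc (Suc k)) \<ge> 1"
    using even by (subst le_divide_eq_1_pos) (simp_all del: cf_rec.simps)
  moreover have "?x (Suc ?n) \<ge> of_nat (Suc k)"
    using Suc by blast
  ultimately have "?x (Suc (Suc (Suc ?n))) \<ge> 1 + of_nat (Suc k)"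
    by (simp only: add_mono)
  then have "?x (Suc (Suc (Suc ?n))) \<ge> of_nat (Suc (Suc k))"
    by (simp only: of_nat_Suc[of "Suc k"])
  with even show ?case by simp
qed

lemma floor_cf_rec_at_top:
  assumes "a \<ge> 0" "b \<ge> 0" "a + b \<ge> 1"
  shows "filterlim (\<lambda>n. \<lfloor>cf_rec a b n\<rfloor>) at_top sequentially"
proof -
  \<comment> \<open>Both 2k + 2 and 2k + 3 have \<open>n div 2\<close> equal to k + 1, the bound of
    \<open>cf_rec_linear_growth\<close>.\<close>
  have "int (n div 2) \<le> \<lfloor>cf_rec a b n\<rfloor>" if n: "n \<ge> 2" for n
  proof (cases "even n")
    case True
    then obtain k where "n = Suc (Suc (2 * k))"
      using n by (metis evenE mult_Suc_right add_2_eq_Suc not_numeral_le_zero mult_0_right old.nat.exhaust)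
    then show ?thesis
      using cf_rec_linear_growth[OF assms, of k] by (simp add: le_floor_iff del: cf_rec.simps)
  next
    case False
    then obtain j where j: "n = Suc (2 * j)" by (metis oddE Suc_eq_plus1)
    with n obtain k where "j = Suc k" by (cases j) auto
    with j have "n = Suc (Suc (Suc (2 * k)))" by simp
    then show ?thesis
      using cf_rec_linear_growth[OF assms, of k] by (simp add: le_floor_iff del: cf_rec.simps)
  qed
  then have "\<forall>\<^sub>F n in sequentially. int (n div 2) \<le> \<lfloor>cf_rec a b n\<rfloor>"
    by (auto simp: eventually_sequentially)
  moreover have "filterlim (\<lambda>n. int (n div 2)) at_top sequentially"
    by (rule filterlim_compose[OF filterlim_int_sequentially filterlim_at_top_div_const_nat]) simp
  ultimately show ?thesis
    by (rule filterlim_at_top_mono[rotated])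
qed

lemma floor_cf_p_at_top: "filterlim (\<lambda>m. \<lfloor>cf_p m\<rfloor>) at_top sequentially"
  unfolding cf_p_def
  by (rule filterlim_compose[OF floor_cf_rec_at_top filterlim_Suc]) auto

lemma floor_cf_q_at_top: "filterlim (\<lambda>m. \<lfloor>cf_q m\<rfloor>) at_top sequentially"
  unfolding cf_q_def
  by (rule filterlim_compose[OF floor_cf_rec_at_top filterlim_Suc]) auto

section \<open>Existence of an admissible sequence\<close>

text \<open>From any index, all sufficiently late indices exceed it in both values, so dependent
  choice builds the subsequence.\<close>

lemma simultaneous_strict_mono_subseq:
  fixes f g :: "nat \<Rightarrow> 'a :: {linorder, no_top}"
  assumes "filterlim f at_top sequentially" "filterlim g at_top sequentially"
  obtains s :: "nat \<Rightarrow> nat" where "strict_mono s" "\<And>i. s i > 0"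
    "strict_mono (\<lambda>i. f (s i))" "strict_mono (\<lambda>i. g (s i))"
proof -
  have "\<exists>y>0. x < y \<and> f x < f y \<and> g x < g y" for x :: nat
  proof -
    have "\<forall>\<^sub>F y in sequentially. x < y \<and> f x < f y \<and> g x < g y"
      by (intro eventually_conj eventually_gt_at_top
            eventually_compose_filterlim[OF eventually_gt_at_top assms(1)]
            eventually_compose_filterlim[OF eventually_gt_at_top assms(2)])
    then show ?thesis
      by (metis (no_types, lifting) eventually_happens' gr_zeroI not_less_zero sequentially_bot)
  qed
  then obtain s :: "nat \<Rightarrow> nat" where "\<forall>n. s n > 0 \<and> s n < s (Suc n) \<and> f (s n) < f (s (Suc n)) \<and> g (s n) < g (s (Suc n))"
    using dependent_nat_choice[of "\<lambda>_ x. x > 0"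
        "\<lambda>_ x y. x < y \<and> f x < f y \<and> g x < g y"] by auto
  then show thesis
    by (intro that[of s]) (auto simp: strict_mono_Suc_iff)
qed

text \<open>This is what remains of \<delta> q_m - p_m once the integer parts are taken out.\<close>

definition frac_defect :: "nat \<Rightarrow> real" where
  "frac_defect m = euler_gompertz * of_rat (frac (cf_q m)) - of_rat (frac (cf_p m))"

lemma abs_of_rat_frac_le_1: "\<bar>of_rat (frac x) :: real\<bar> \<le> 1"
proof -
  have "(of_rat 0 :: real) \<le> of_rat (frac x)" "of_rat (frac x) \<le> (of_rat 1 :: real)"
    using frac_ge_0[of x] frac_lt_1[of x] by (simp_all only: of_rat_less_eq less_imp_le)
  then show ?thesis by simp
qed

lemma bounded_frac_defect: "bounded (range frac_defect)"
proof -
  have "\<bar>frac_defect m\<bar> \<le> \<bar>euler_gompertz\<bar> + 1" for m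
  proof -
    have "\<bar>euler_gompertz * of_rat (frac (cf_q m))\<bar> \<le> \<bar>euler_gompertz\<bar> * 1"
      unfolding abs_mult by (intro mult_left_mono abs_of_rat_frac_le_1) auto
    then show ?thesis
      using abs_of_rat_frac_le_1[of "cf_p m"] unfolding frac_defect_def by linarith
  qed
  then show ?thesis by (auto simp: bounded_iff)
qed

text \<open>First \<open>r\<close> makes the fractional parts converge, then \<open>s\<close> thins
  it out until both floors increase strictly; thinning preserves the limit.\<close>

lemma exists_admissible: "\<exists>m. admissible m"
proof -
  obtain l and r :: "nat \<Rightarrow> nat" where r: "strict_mono r" "(frac_defect \<circ> r) \<longlonglongrightarrow> l"
    using bounded_imp_convergent_subsequence[OF bounded_frac_defect] by blast
  have "filterlim (\<lambda>i. \<lfloor>cf_p (r i)\<rfloor>) at_top sequentially" "filterlim (\<lambda>i. \<lfloor>cf_q (r i)\<rfloor>) at_top sequentially"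
    using filterlim_compose[OF floor_cf_p_at_top filterlim_subseq[OF r(1)]]
      filterlim_compose[OF floor_cf_q_at_top filterlim_subseq[OF r(1)]] by auto
  then obtain s :: "nat \<Rightarrow> nat" where s: "strict_mono s" "\<And>i. s i > 0"
    "strict_mono (\<lambda>i. \<lfloor>cf_p (r (s i))\<rfloor>)" "strict_mono (\<lambda>i. \<lfloor>cf_q (r (s i))\<rfloor>)"
    using simultaneous_strict_mono_subseq by blast
  have "convergent (\<lambda>i. frac_defect (r (s i)))"
    using LIMSEQ_subseq_LIMSEQ[OF r(2) s(1)] by (auto simp: convergent_def o_def)
  \<comment> \<open>A strictly increasing \<open>r\<close> satisfies r n \<ge> n, so positivity
    passes from \<open>s i\<close> to \<open>r (s i)\<close>.\<close>
  moreover have "r (s i) > 0" for i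
    using s(2)[of i] seq_suble[OF r(1), of "s i"] by linarith
  moreover have "strict_mono (\<lambda>i. r (s i))"
    using strict_mono_o[OF r(1) s(1)] by (simp add: o_def)
  ultimately have "admissible (r \<circ> s)"
    using s by (simp add: admissible_def frac_defect_def o_def)
  then show ?thesis by blast
qed

section \<open>Small integer linear forms and irrationality\<close>

text \<open>The integer parts form \<delta> [q] - [p], the difference of a null sequence and a
  convergent one. It therefore converges, and its consecutive differences tend to 0.\<close>

lemma admissible_differences_tendsto_0:
  assumes "admissible m"
  shows "(\<lambda>i. euler_gompertz * real_of_int (B_seq m i) - real_of_int (A_seq m i)) \<longlonglongrightarrow> 0"
proof -
  define X where
    "X i = (euler_gompertz * of_rat (cf_q (m i)) - of_rat (cf_p (m i))) - frac_defect (m i)" for i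
  have "strict_mono m" and "convergent (\<lambda>i. frac_defect (m i))"
    using assms by (auto simp: admissible_def frac_defect_def)
  then obtain l where "(\<lambda>i. frac_defect (m i)) \<longlonglongrightarrow> l"
    by (auto simp: convergent_def)
  moreover have "(\<lambda>i. euler_gompertz * of_rat (cf_q (m i)) - of_rat (cf_p (m i))) \<longlonglongrightarrow> 0"
    using LIMSEQ_subseq_LIMSEQ[OF gompertz_approximation_tendsto_0 \<open>strict_mono m\<close>] by (simp add: o_def)
  ultimately have "X \<longlonglongrightarrow> 0 - l"
    unfolding X_def by (intro tendsto_diff)
  then have "(\<lambda>i. X (Suc i) - X i) \<longlonglongrightarrow> (0 - l) - (0 - l)"
    by (intro tendsto_diff LIMSEQ_Suc)
  moreover have "X i = euler_gompertz * of_int \<lfloor>cf_q (m i)\<rfloor> - of_int \<lfloor>cf_p (m i)\<rfloor>" for i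
    by (simp add: X_def frac_defect_def frac_def of_rat_diff algebra_simps)
  ultimately show ?thesis
    by (simp add: A_seq_def B_seq_def algebra_simps)
qed

text \<open>For x = a / b every term is an integer multiple of 1 / b, so it vanishes as soon as it
  is smaller than 1 / b in absolute value.\<close>

lemma eventually_eq_0_if_rational:
  fixes x :: real and A B :: "nat \<Rightarrow> int"
  assumes "x \<in> \<rat>" and "(\<lambda>i. x * of_int (B i) - of_int (A i)) \<longlonglongrightarrow> 0"
  shows "\<forall>\<^sub>F i in sequentially. x * of_int (B i) = of_int (A i)"
proof -
  obtain a b :: int where b: "b > 0" and x: "x = of_int a / of_int b"
    using \<open>x \<in> \<rat>\<close> by (rule Rats_cases')
  have "\<forall>\<^sub>F i in sequentially. \<bar>x * of_int (B i) - of_int (A i)\<bar> < 1 / of_int b"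
    using tendstoD[OF assms(2), of "1 / of_int b"] b by (simp add: dist_real_def)
  then show ?thesis
  proof eventually_elim
    case (elim i)
    have eq: "x * of_int (B i) - of_int (A i) = of_int (a * B i - b * A i) / of_int b"
      using b by (simp add: x field_simps)
    with elim b have "\<bar>of_int (a * B i - b * A i) :: real\<bar> < 1"
      by (simp add: divide_less_cancel del: of_int_diff of_int_mult)
    then have "a * B i - b * A i = 0" by linarith
    with eq show ?case by simp
  qed
qed

theorem mainTheorem7:
  "(\<exists>m. admissible m) \<and>
   (\<forall>m. admissible m \<longrightarrow>
      (\<lambda>i. euler_gompertz * real_of_int (B_seq m i) - real_of_int (A_seq m i)) \<longlonglongrightarrow> 0 \<and>
      ((\<forall>i. euler_gompertz \<noteq> real_of_int (A_seq m i) / real_of_int (B_seq m i)) \<longrightarrow>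
         euler_gompertz \<notin> \<rat>))"
proof (intro conjI allI impI notI)
  show "\<exists>m. admissible m" by (rule exists_admissible)
next
  fix m
  assume "admissible m"
  then show "(\<lambda>i. euler_gompertz * real_of_int (B_seq m i) - real_of_int (A_seq m i)) \<longlonglongrightarrow> 0"
    by (rule admissible_differences_tendsto_0)
next
  fix m
  assume m: "admissible m" and "euler_gompertz \<in> \<rat>"
    and neq: "\<forall>i. euler_gompertz \<noteq> real_of_int (A_seq m i) / real_of_int (B_seq m i)"
  then obtain i where eq: "euler_gompertz * real_of_int (B_seq m i) = real_of_int (A_seq m i)"
    using eventually_eq_0_if_rational[OF _ admissible_differences_tendsto_0]
    by (meson eventually_happens' sequentially_bot)
  \<comment> \<open>Strict increase of the floors of q_m permits the division and excludes the
    default value of a quotient by 0.\<close>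
  have "B_seq m i > 0"
    using m by (auto simp: admissible_def B_seq_def strict_mono_Suc_iff)
  with eq have "euler_gompertz = real_of_int (A_seq m i) / real_of_int (B_seq m i)"
    by (simp add: field_simps)
  with neq show False by blast
qed

end
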